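(* Let $k\ge 2$. The Thompson-Higman monoid $M_{k,1}$ is (isomorphic to) a submonoid of the multiplicative monoid of the Cuntz algebra ${\cal O}_k$.
   Context: Let $k\ge 2$ and $A=\{a_1,\dots,a_k\}$ an alphabet; $A^*$ is the set of all finite words over $A$, with empty word $\varepsilon$. A right ideal of $A^*$ is a set $R\subseteq A^*$ with $RA^*\subseteq R$ (the empty set is allowed). A prefix code is a set $C\subseteq A^*$ in which no element is a prefix of another element. Every right ideal $R$ equals $CA^*$ for a unique prefix code $C$; $R$ is finitely generated iff $C$ is finite. A right ideal homomorphism is a total function $\varphi: R_1\to A^*$, where $R_1={\rm Dom}(\varphi)$ is a right ideal, with $\varphi(xw)=\varphi(x)w$ for all $x\in R_1$, $w\in A^*$. For right ideals $R'\subseteq R$, $R'$ is essential in $R$ iff $R'$ intersects every non-empty right ideal contained in $R$. $\varphi$ is an essential extension of $\Phi$ iff ${\rm Dom}(\Phi)$ is contained and essential in ${\rm Dom}(\varphi)$ and $\varphi=\Phi$ on ${\rm Dom}(\Phi)$. Every right ideal homomorphism $\varphi$ with finitely generated domain has a unique maximal essential extension $\max(\varphi)$. $M_{k,1}$ is the monoid of all maximal essential extensions of right ideal homomorphisms between finitely generated right ideals of $A^*$, with multiplication $\varphi\cdot\psi=\max(\varphi\circ\psi)$. The Cuntz algebra ${\cal O}_k$ (considered here purely algebraically, without norm or completion) is the star-algebra over $\mathbb{C}$ with identity ${\bf 1}$ and zero ${\bf 0}$ generated by $a_1,\dots,a_k$, with star-inverses denoted $\overline{a}_1,\dots,\overline{a}_k$,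 presented by the relations $\overline{a}_i a_i={\bf 1}$ for all $i$; $\overline{a}_i a_j={\bf 0}$ for $i\ne j$; and $a_1\overline{a}_1+\dots+a_k\overline{a}_k={\bf 1}$. *)

theory Defs
  imports Complex_Main "HOL-Algebra.QuotRing" "HOL-Library.Sublist" "HOL-Library.Poly_Mapping"
begin

section \<open>Right ideals of the free monoid of words\<close>

text \<open>
  The alphabet is a finite type \<open>'a\<close>, and words are lists over it.
\<close>

definition right_ideal :: "'a list set \<Rightarrow> bool" where
  "right_ideal R \<longleftrightarrow> (\<forall>x\<in>R. \<forall>w. x @ w \<in> R)"

definition prefix_code :: "'a list set \<Rightarrow> bool" where
  "prefix_code C \<longleftrightarrow> (\<forall>x\<in>C. \<forall>y\<in>C. prefix x y \<longrightarrow> x = y)"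

definition fg_right_ideal :: "'a list set \<Rightarrow> bool" where
  "fg_right_ideal R \<longleftrightarrow> (\<exists>C. prefix_code C \<and> finite C \<and> R = {c @ w | c w. c \<in> C})"

definition essential_in :: "'a list set \<Rightarrow> 'a list set \<Rightarrow> bool" where
  "essential_in R' R \<longleftrightarrow>
     R' \<subseteq> R \<and> (\<forall>I. right_ideal I \<and> I \<noteq> {} \<and> I \<subseteq> R \<longrightarrow> R' \<inter> I \<noteq> {})"


section \<open>The Thompson-Higman monoid\<close>

text \<open>
  A function that is total on its domain of definition, a subset of the set of words,
  is a map in the sense of \<^theory>\<open>HOL.Map\<close>; composition is \<^term>\<open>(\<circ>\<^sub>m)\<close>.
\<close>

definition right_ideal_hom :: "('a list \<rightharpoonup> 'a list) \<Rightarrow> bool" where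
  "right_ideal_hom \<phi> \<longleftrightarrow>
     right_ideal (dom \<phi>) \<and> (\<forall>x y w. \<phi> x = Some y \<longrightarrow> \<phi> (x @ w) = Some (y @ w))"

definition essential_extension ::
    "('a list \<rightharpoonup> 'a list) \<Rightarrow> ('a list \<rightharpoonup> 'a list) \<Rightarrow> bool" where
  "essential_extension \<phi> \<Phi> \<longleftrightarrow>
     right_ideal_hom \<phi> \<and> right_ideal_hom \<Phi> \<and>
     essential_in (dom \<Phi>) (dom \<phi>) \<and> (\<forall>x\<in>dom \<Phi>. \<phi> x = \<Phi> x)"

definition max_extension :: "('a list \<rightharpoonup> 'a list) \<Rightarrow> ('a list \<rightharpoonup> 'a list)" where
  "max_extension \<phi> =
     (THE \<psi>. essential_extension \<psi> \<phi> \<and> (\<forall>\<chi>. essential_extension \<chi> \<psi> \<longrightarrow> \<chi> = \<psi>))"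

definition thompson_higman_monoid :: "('a list \<rightharpoonup> 'a list) monoid" where
  "thompson_higman_monoid =
     \<lparr> carrier = {max_extension \<phi> | \<phi>.
         right_ideal_hom \<phi> \<and> fg_right_ideal (dom \<phi>) \<and> fg_right_ideal (ran \<phi>)},
       monoid.mult = (\<lambda>\<phi> \<psi>. max_extension (\<phi> \<circ>\<^sub>m \<psi>)),
       one = Some \<rparr>"


section \<open>The free star-algebra\<close>

text \<open>
  Words form a monoid under concatenation. It is written additively, since this is how the
  product of \<^typ>\<open>'b::monoid_add \<Rightarrow>\<^sub>0 'c::semiring_0\<close> (convolution) expects its exponents. Hence
  \<open>'a letter list \<Rightarrow>\<^sub>0 complex\<close> is the free unital complex algebra on the letters.
\<close>

instantiation list :: (type) monoid_add
begin

definition zero_list :: "'a list" where "zero_list = []"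

definition plus_list :: "'a list \<Rightarrow> 'a list \<Rightarrow> 'a list" where "plus_list = (@)"

instance
  by standard (simp_all add: zero_list_def plus_list_def)

end

datatype 'a letter = Gen 'a | Bar 'a

fun bar_letter :: "'a letter \<Rightarrow> 'a letter" where
  "bar_letter (Gen a) = Bar a"
| "bar_letter (Bar a) = Gen a"

type_synonym 'a free_star_alg = "'a letter list \<Rightarrow>\<^sub>0 complex"

definition gen :: "'a \<Rightarrow> 'a free_star_alg" where
  "gen a = Poly_Mapping.single [Gen a] 1"

definition bar :: "'a \<Rightarrow> 'a free_star_alg" where
  "bar a = Poly_Mapping.single [Bar a] 1"

text \<open>
  The involution: the conjugate-linear anti-automorphism exchanging \<^term>\<open>gen a\<close> and
  \<^term>\<open>bar a\<close>.
\<close>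

definition star :: "'a free_star_alg \<Rightarrow> 'a free_star_alg" where
  "star f = (\<Sum>w\<in>Poly_Mapping.keys f.
     Poly_Mapping.single (rev (map bar_letter w)) (cnj (Poly_Mapping.lookup f w)))"

definition free_star_algebra :: "'a free_star_alg ring" where
  "free_star_algebra =
     \<lparr> carrier = UNIV, monoid.mult = (*), one = 1, ring.zero = 0, add = (+) \<rparr>"

lemma ring_free_star_algebra: "ring free_star_algebra"
proof (rule ringI)
  show "abelian_group (free_star_algebra :: 'a free_star_alg ring)"
  proof (rule abelian_groupI)
    fix x :: "'a free_star_alg"
    show "\<exists>y\<in>carrier free_star_algebra. y \<oplus>\<^bsub>free_star_algebra\<^esub> x = \<zero>\<^bsub>free_star_algebra\<^esub>"
      by (rule bexI[of _ "- x"]) (simp_all add: free_star_algebra_def)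
  qed (simp_all add: free_star_algebra_def algebra_simps)
  show "Group.monoid (free_star_algebra :: 'a free_star_alg ring)"
    by (rule monoidI) (simp_all add: free_star_algebra_def algebra_simps)
qed (simp_all add: free_star_algebra_def algebra_simps)


section \<open>The Cuntz algebra\<close>

definition cuntz_relators :: "'a::finite free_star_alg set" where
  "cuntz_relators =
     {bar i * gen i - 1 | i. True} \<union>
     {bar i * gen j | i j. i \<noteq> j} \<union>
     {(\<Sum>i\<in>UNIV. gen i * bar i) - 1}"

text \<open>
  The star-algebra with these relators is the quotient of the free star-algebra by the
  star-closed ideal they generate. Being two-sided and the ring being unital, the ideal
  is closed under scalar multiplication, so the ring quotient is the algebra quotient. Its
  elements are the cosets of the ideal; the ring record carries the multiplicative monoid.
\<close>

definition cuntz_ideal :: "'a::finite free_star_alg set" where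
  "cuntz_ideal = Idl\<^bsub>free_star_algebra\<^esub> (cuntz_relators \<union> star ` cuntz_relators)"

definition cuntz_algebra :: "'a::finite free_star_alg set ring" where
  "cuntz_algebra = free_star_algebra Quot cuntz_ideal"

lemma ring_cuntz_algebra: "ring (cuntz_algebra :: 'a::finite free_star_alg set ring)"
  unfolding cuntz_algebra_def cuntz_ideal_def
  by (intro ideal.quotient_is_ring ring.genideal_ideal ring_free_star_algebra)
    (simp add: free_star_algebra_def)

end

theory Submission
  imports Defs "HOL-Library.Stream"
begin

text \<open>
  The embedding sends a homomorphism \<open>\<phi>\<close> to the element \<open>\<Sum>\<^sub>w \<phi>(w) w'\<close> of the Cuntz algebra, where
  \<open>w'\<close> is the star-inverse of \<open>w\<close> and the sum runs over all words \<open>w\<close> of a fixed, sufficiently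
  large length \<open>n\<close> in the domain of \<open>\<phi>\<close> (\<open>level_sum\<close>, \<open>cuntz_image\<close>). As an operator it replaces the
  prefix \<open>w\<close> of an infinite word by \<open>\<phi>(w)\<close>.

  Sufficiently large means at least the length \<open>N\<close> of the longest word of the prefix code that
  generates the domain. What matters about \<open>N\<close> is that a word of length at least \<open>N\<close> belongs to the
  domain as soon as one of its extensions does (\<open>decided_from\<close>). Over a finite alphabet this property
  characterises finitely generated right ideals (\<open>fg_right_ideal_iff_decided_from\<close>), and it is
  inherited by the domains of compositions and of essential extensions.

  The sum is well defined: passing from length \<open>n\<close> to \<open>n + 1\<close> inserts the relation \<open>\<Sum>\<^sub>a a a' = 1\<close>
  into every term (\<open>level_sum_Suc\<close>). It does not see the difference between \<open>\<phi>\<close> and its maximal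
  essential extension, because the two agree on all words of length at least \<open>N\<close>
  (\<open>essential_extension_same_value\<close>). It is multiplicative: if the words \<open>w\<close> in the sum for \<open>\<psi>\<close> are
  so long that each \<open>\<psi>(w)\<close> has length at least \<open>n\<close>, then among the products \<open>\<phi>(u) u' \<psi>(w) w'\<close> with
  \<open>u\<close> of length \<open>n\<close> at most the one where \<open>u\<close> is a prefix of \<open>\<psi>(w)\<close> survives, and it equals
  \<open>\<phi>(\<psi>(w)) w'\<close> (\<open>level_sum_mult\<close>).

  For injectivity, the Cuntz algebra acts on the complex functions on infinite words
  (\<open>action_cuntz_ideal\<close>). The image of \<open>\<phi>\<close> maps the indicator of \<open>w t\<close> to that of \<open>\<phi>(w) t\<close>. Hence if
  \<open>\<phi>\<close> and \<open>\<psi>\<close> have the same image, then, for every long word \<open>w\<close>, either both are undefined at \<open>w\<close> or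
  \<open>\<phi>(w) t = \<psi>(w) t\<close> for all infinite words \<open>t\<close>; as there are two different letters, the latter forces
  \<open>\<phi>(w) = \<psi>(w)\<close>. So \<open>\<phi>\<close> and \<open>\<psi>\<close> agree on all long words, and both are the maximal essential
  extension of their common restriction to these (\<open>inextensible_eqI\<close>).
\<close>


section \<open>Finitely generated right ideals\<close>

text \<open>
  For a right ideal over a finite alphabet this is finite generation in disguise: whether a long
  word belongs to \<open>R\<close> can be read off from its first \<open>N\<close> letters. In this form it passes to the
  domains of compositions and of essential extensions without any computation of prefix codes.
\<close>

definition decided_from :: "nat \<Rightarrow> 'a list set \<Rightarrow> bool" where
  "decided_from N R \<longleftrightarrow> (\<forall>w v. N \<le> length w \<longrightarrow> w @ v \<in> R \<longrightarrow> w \<in> R)"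

lemma decided_from_append_iff:
  assumes "decided_from N R" "right_ideal R" "N \<le> length w"
  shows "w @ v \<in> R \<longleftrightarrow> w \<in> R"
  using assms unfolding decided_from_def right_ideal_def by blast

lemma decided_from_take:
  assumes "decided_from N R" "w \<in> R" "N \<le> n" "n \<le> length w"
  shows "take n w \<in> R"
  using assms by (metis append_take_drop_id decided_from_def length_take min_absorb2)

text \<open>
  The generators that are minimal for the prefix order form a prefix code, and each generator
  extends a minimal one, so dropping the others does not change the ideal.
\<close>

lemma fg_right_idealI:
  assumes "finite F"
  shows "fg_right_ideal {c @ w | c w. c \<in> F}"
proof -
  define C where "C = {c \<in> F. \<forall>d\<in>F. prefix d c \<longrightarrow> d = c}"
  have minimal: "\<exists>d\<in>C. prefix d c" if "c \<in> F" for c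
    using that
  proof (induction "length c" arbitrary: c rule: less_induct)
    case less
    show ?case
    proof (cases "c \<in> C")
      case False
      with less.prems obtain d where d: "d \<in> F" "prefix d c" "d \<noteq> c"
        by (auto simp: C_def)
      then have "length d < length c"
        by (metis prefix_length_less prefix_order.le_imp_less_or_eq)
      from less.hyps[OF this d(1)] d(2) show ?thesis
        by (meson prefix_order.trans)
    qed auto
  qed
  have "{c @ w | c w. c \<in> F} = {c @ w | c w. c \<in> C}"
  proof
    show "{c @ w | c w. c \<in> F} \<subseteq> {c @ w | c w. c \<in> C}"
    proof clarify
      fix c w assume "c \<in> F"
      then obtain d v where "d \<in> C" "c = d @ v"
        using minimal by (meson prefixE)
      then show "\<exists>c' w'. c @ w = c' @ w' \<and> c' \<in> C" by auto
    qed
  qed (auto simp: C_def)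
  moreover have "prefix_code C" "finite C"
    using assms by (auto simp: prefix_code_def C_def)
  ultimately show ?thesis
    unfolding fg_right_ideal_def by blast
qed

text \<open>
  If \<open>R = C A\<^sup>*\<close> and no word of \<open>C\<close> is longer than \<open>N\<close>, then a word of \<open>C\<close> that is a prefix of an
  extension of a word of length at least \<open>N\<close> is already a prefix of that word. Conversely, the
  words of \<open>R\<close> of length at most \<open>N\<close> generate \<open>R\<close>, and there are finitely many of them because the
  alphabet is finite.
\<close>

lemma fg_right_ideal_iff_decided_from:
  fixes R :: "'a::finite list set"
  shows "fg_right_ideal R \<longleftrightarrow> right_ideal R \<and> (\<exists>N. decided_from N R)"
proof
  assume "fg_right_ideal R"
  then obtain C where C: "finite C" and R: "R = {c @ w | c w. c \<in> C}"
    by (auto simp: fg_right_ideal_def)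
  define N where "N = Max (insert 0 (length ` C))"
  have len: "length c \<le> N" if "c \<in> C" for c
    unfolding N_def using C that by (auto intro!: Max_ge)
  have "right_ideal R"
    unfolding right_ideal_def R by force
  moreover have "decided_from N R"
    unfolding decided_from_def
  proof (intro allI impI)
    fix w v assume "N \<le> length w" "w @ v \<in> R"
    then obtain c u where c: "c \<in> C" "w @ v = c @ u"
      unfolding R by auto
    with len[OF c(1)] \<open>N \<le> length w\<close> have "w = c @ take (length w - length c) u"
      by (metis append_eq_append_conv_if append_eq_conv_conj le_trans take_append take_all)
    with c(1) show "w \<in> R"
      unfolding R by blast
  qed
  ultimately show "right_ideal R \<and> (\<exists>N. decided_from N R)" by blast
next
  assume "right_ideal R \<and> (\<exists>N. decided_from N R)"
  then obtain N where R: "right_ideal R" and N: "decided_from N R" by blast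
  define F where "F = {c \<in> R. length c \<le> N}"
  have "finite {c :: 'a list. length c \<le> N}"
    using finite_lists_length_le[of "UNIV :: 'a set" N] by simp
  then have fin: "finite F" by (simp add: F_def)
  have R_eq: "R = {c @ w | c w. c \<in> F}"
  proof (intro equalityI subsetI)
    fix x assume x: "x \<in> R"
    have "take N x \<in> F"
      using x decided_from_take[OF N x, of N] by (cases "N \<le> length x") (auto simp: F_def)
    then show "x \<in> {c @ w | c w. c \<in> F}"
      by (metis (mono_tags, lifting) append_take_drop_id mem_Collect_eq)
  next
    fix x assume "x \<in> {c @ w | c w. c \<in> F}"
    then show "x \<in> R"
      using R by (auto simp: F_def right_ideal_def)
  qed
  from fg_right_idealI[OF fin] show "fg_right_ideal R"
    unfolding R_eq[symmetric] .
qed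

lemma right_ideal_hom_append:
  assumes "right_ideal_hom \<phi>" "\<phi> x = Some y"
  shows "\<phi> (x @ w) = Some (y @ w)"
  using assms by (auto simp: right_ideal_hom_def)

text \<open>
  The images of the finitely many generators of the domain generate the range.
\<close>

lemma fg_right_ideal_ran:
  assumes "right_ideal_hom \<phi>" "fg_right_ideal (dom \<phi>)"
  shows "fg_right_ideal (ran \<phi>)"
proof -
  obtain C where C: "finite C" and dom: "dom \<phi> = {c @ w | c w. c \<in> C}"
    using assms(2) by (auto simp: fg_right_ideal_def)
  define F where "F = (\<lambda>c. the (\<phi> c)) ` C"
  have val: "\<phi> c = Some (the (\<phi> c))" if "c \<in> C" for c
  proof -
    have "c @ [] \<in> dom \<phi>" unfolding dom using that by blast
    then show ?thesis by auto
  qed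
  have "ran \<phi> = {c @ w | c w. c \<in> F}"
  proof (intro equalityI subsetI)
    fix y assume "y \<in> ran \<phi>"
    then obtain x where x: "\<phi> x = Some y" by (auto simp: ran_def)
    then have "x \<in> dom \<phi>" by auto
    then obtain c w where "x = c @ w" "c \<in> C"
      unfolding dom by auto
    with x right_ideal_hom_append[OF assms(1) val, of c w]
    show "y \<in> {c @ w | c w. c \<in> F}"
      by (auto simp: F_def)
  next
    fix y assume "y \<in> {c @ w | c w. c \<in> F}"
    then obtain c w where "c \<in> C" "y = the (\<phi> c) @ w"
      by (auto simp: F_def)
    with right_ideal_hom_append[OF assms(1) val, of c w] show "y \<in> ran \<phi>"
      by (auto simp: ran_def)
  qed
  with fg_right_idealI[of F] C show ?thesis
    by (simp add: F_def)
qed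


section \<open>The maximal essential extension\<close>

text \<open>
  Essentiality need only be tested on principal right ideals \<open>x A\<^sup>*\<close>, since every non-empty
  right ideal contains one. This turns it into a density condition on words.
\<close>

lemma essential_extension_iff:
  "essential_extension \<psi> \<phi> \<longleftrightarrow>
     right_ideal_hom \<psi> \<and> right_ideal_hom \<phi> \<and> \<phi> \<subseteq>\<^sub>m \<psi> \<and> (\<forall>x\<in>dom \<psi>. \<exists>w. x @ w \<in> dom \<phi>)"
proof -
  have "essential_in (dom \<phi>) (dom \<psi>) \<longleftrightarrow>
      dom \<phi> \<subseteq> dom \<psi> \<and> (\<forall>x\<in>dom \<psi>. \<exists>w. x @ w \<in> dom \<phi>)"
    if "right_ideal (dom \<psi>)"
  proof -
    have "\<exists>w. x @ w \<in> dom \<phi>"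
      if "x \<in> dom \<psi>" and ess: "essential_in (dom \<phi>) (dom \<psi>)" for x
    proof -
      \<comment> \<open>test essentiality on the principal right ideal of \<open>x\<close>\<close>
      let ?I = "{x @ w | w. True}"
      have "right_ideal ?I" unfolding right_ideal_def by force
      moreover have "?I \<noteq> {}" by blast
      moreover have "?I \<subseteq> dom \<psi>"
        using \<open>right_ideal (dom \<psi>)\<close> that(1) unfolding right_ideal_def by blast
      ultimately have "dom \<phi> \<inter> ?I \<noteq> {}"
        using ess unfolding essential_in_def by blast
      then show ?thesis by blast
    qed
    moreover have "essential_in (dom \<phi>) (dom \<psi>)"
      if "dom \<phi> \<subseteq> dom \<psi>" and "\<forall>x\<in>dom \<psi>. \<exists>w. x @ w \<in> dom \<phi>"
      using that unfolding essential_in_def right_ideal_def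
      by (metis disjoint_iff equals0I subset_iff)
    moreover have "dom \<phi> \<subseteq> dom \<psi>" if "essential_in (dom \<phi>) (dom \<psi>)"
      using that by (simp add: essential_in_def)
    ultimately show ?thesis by blast
  qed
  then show ?thesis
    unfolding essential_extension_def map_le_def
    by (auto simp: right_ideal_hom_def) (metis domI domIff)+
qed

lemma essential_extension_trans:
  assumes "essential_extension \<chi> \<psi>" "essential_extension \<psi> \<phi>"
  shows "essential_extension \<chi> \<phi>"
  using assms unfolding essential_extension_iff
  by (metis append.assoc map_le_trans)

text \<open>
  The pair \<open>(x, y)\<close> may be added to \<open>\<phi>\<close> exactly if the domain of \<open>\<phi>\<close> is dense below \<open>x\<close> and all values
  of \<open>\<phi>\<close> there are consistent with sending \<open>x\<close> to \<open>y\<close>. Adding all such pairs at once gives an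
  explicit form of the maximal essential extension.
\<close>

definition extends_at :: "('a list \<rightharpoonup> 'a list) \<Rightarrow> 'a list \<Rightarrow> 'a list \<Rightarrow> bool" where
  "extends_at \<phi> x y \<longleftrightarrow>
     (\<forall>w. \<exists>v. x @ w @ v \<in> dom \<phi>) \<and> (\<forall>w z. \<phi> (x @ w) = Some z \<longrightarrow> z = y @ w)"

definition largest_extension :: "('a list \<rightharpoonup> 'a list) \<Rightarrow> ('a list \<rightharpoonup> 'a list)" where
  "largest_extension \<phi> x =
     (if \<exists>y. extends_at \<phi> x y then Some (THE y. extends_at \<phi> x y) else None)"

text \<open>
  Density provides some \<open>x v\<close> in the domain, and its image \<open>y v\<close> determines \<open>y\<close> by cancellation.
\<close>

lemma extends_at_unique:
  assumes "extends_at \<phi> x y" "extends_at \<phi> x y'"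
  shows "y = y'"
proof -
  obtain v where "x @ [] @ v \<in> dom \<phi>"
    using assms(1) unfolding extends_at_def by blast
  then obtain z where "\<phi> (x @ v) = Some z" by auto
  with assms have "z = y @ v" "z = y' @ v"
    unfolding extends_at_def by blast+
  then show ?thesis by simp
qed

lemma largest_extension_eq_Some: "largest_extension \<phi> x = Some y \<longleftrightarrow> extends_at \<phi> x y"
  unfolding largest_extension_def
  by (metis extends_at_unique option.discI option.inject the_equality)

lemma extends_at_if_essential_extension:
  assumes "essential_extension \<psi> \<phi>" "\<psi> x = Some y"
  shows "extends_at \<phi> x y"
  unfolding extends_at_def
proof (intro conjI allI impI)
  from assms have hom: "right_ideal_hom \<psi>" and le: "\<phi> \<subseteq>\<^sub>m \<psi>"
      and dense: "\<forall>x\<in>dom \<psi>. \<exists>w. x @ w \<in> dom \<phi>"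
    by (auto simp: essential_extension_iff)
  have *: "\<psi> (x @ w) = Some (y @ w)" for w
    using right_ideal_hom_append[OF hom assms(2)] .
  then show "\<exists>v. x @ w @ v \<in> dom \<phi>" for w
    using dense by (metis append.assoc domI)
  show "z = y @ w" if "\<phi> (x @ w) = Some z" for w z
    using that le * by (metis domI map_le_def option.inject)
qed

lemma right_ideal_hom_largest_extension: "right_ideal_hom (largest_extension \<phi>)"
proof -
  have "extends_at \<phi> (x @ w) (y @ w)" if "extends_at \<phi> x y" for x y w
    using that unfolding extends_at_def by (metis append.assoc)
  then show ?thesis
    unfolding right_ideal_hom_def right_ideal_def
    by (metis domD domI largest_extension_eq_Some)
qed

lemma essential_extension_largest_extension:
  assumes "right_ideal_hom \<phi>"
  shows "essential_extension (largest_extension \<phi>) \<phi>"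
proof -
  have "extends_at \<phi> x y" if "\<phi> x = Some y" for x y
  proof (rule extends_at_if_essential_extension[where \<psi> = \<phi>])
    show "essential_extension \<phi> \<phi>"
      using assms by (auto simp: essential_extension_iff intro: exI[of _ "[]"])
  qed (fact that)
  then have "\<phi> \<subseteq>\<^sub>m largest_extension \<phi>"
    by (metis domD largest_extension_eq_Some map_le_def)
  moreover have "\<exists>w. x @ w \<in> dom \<phi>" if "x \<in> dom (largest_extension \<phi>)" for x
  proof -
    from that obtain y where "extends_at \<phi> x y"
      by (metis domD largest_extension_eq_Some)
    then obtain v where "x @ [] @ v \<in> dom \<phi>"
      unfolding extends_at_def by blast
    then show ?thesis by auto
  qed
  ultimately show ?thesis
    using assms right_ideal_hom_largest_extension by (auto simp: essential_extension_iff)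
qed

lemma essential_extension_largest:
  assumes "essential_extension \<psi> \<phi>"
  shows "essential_extension (largest_extension \<phi>) \<psi>"
proof -
  have hom: "right_ideal_hom \<psi>" "right_ideal_hom \<phi>" and le: "\<phi> \<subseteq>\<^sub>m \<psi>"
    using assms by (auto simp: essential_extension_iff)
  have "\<psi> \<subseteq>\<^sub>m largest_extension \<phi>"
    using extends_at_if_essential_extension[OF assms]
    by (metis domD largest_extension_eq_Some map_le_def)
  then show ?thesis
    using essential_extension_largest_extension[OF hom(2)] hom map_le_implies_dom_le[OF le]
    unfolding essential_extension_iff by blast
qed

definition inextensible :: "('a list \<rightharpoonup> 'a list) \<Rightarrow> bool" where
  "inextensible \<psi> \<longleftrightarrow> (\<forall>\<chi>. essential_extension \<chi> \<psi> \<longrightarrow> \<chi> = \<psi>)"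

text \<open>
  Every essential extension of \<open>\<phi>\<close> is contained in the largest one, and a further extension of that
  is, by transitivity, an essential extension of \<open>\<phi>\<close> again. So it is maximal, and any maximal one
  equals it.
\<close>

lemma max_extension_eq_largest_extension:
  assumes "right_ideal_hom \<phi>"
  shows "max_extension \<phi> = largest_extension \<phi>"
    and "inextensible (largest_extension \<phi>)"
proof -
  show max: "inextensible (largest_extension \<phi>)"
    unfolding inextensible_def
  proof (intro allI impI)
    fix \<chi> assume \<chi>: "essential_extension \<chi> (largest_extension \<phi>)"
    with assms have "essential_extension \<chi> \<phi>"
      using essential_extension_largest_extension essential_extension_trans by blast
    then have "\<chi> \<subseteq>\<^sub>m largest_extension \<phi>"
      using essential_extension_largest unfolding essential_extension_iff by blast
    with \<chi> show "\<chi> = largest_extension \<phi>"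
      unfolding essential_extension_iff by (blast intro: map_le_antisym)
  qed
  show "max_extension \<phi> = largest_extension \<phi>"
    unfolding max_extension_def
  proof (rule the_equality)
    show "essential_extension (largest_extension \<phi>) \<phi> \<and>
        (\<forall>\<chi>. essential_extension \<chi> (largest_extension \<phi>) \<longrightarrow> \<chi> = largest_extension \<phi>)"
      using essential_extension_largest_extension[OF assms] max by (simp add: inextensible_def)
  qed (metis essential_extension_largest)
qed

lemma essential_extension_max_extension:
  "right_ideal_hom \<phi> \<Longrightarrow> essential_extension (max_extension \<phi>) \<phi>"
  by (simp add: max_extension_eq_largest_extension essential_extension_largest_extension)

lemma inextensible_max_extension: "right_ideal_hom \<phi> \<Longrightarrow> inextensible (max_extension \<phi>)"
  by (simp add: max_extension_eq_largest_extension)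

lemma max_extension_unique:
  assumes "essential_extension \<psi> \<phi>" "inextensible \<psi>"
  shows "\<psi> = max_extension \<phi>"
  using assms essential_extension_largest[OF assms(1)] max_extension_eq_largest_extension(1)[of \<phi>]
  by (auto simp: inextensible_def essential_extension_iff)

text \<open>
  A long word in the larger domain has an extension in the domain of \<open>\<phi>\<close>, hence lies in it itself:
  essential extensions add only short words. This is why the choice between \<open>\<phi>\<close> and its maximal
  extension will not affect sums over long words.
\<close>

lemma essential_extension_same_value:
  assumes "essential_extension \<psi> \<phi>" "decided_from N (dom \<phi>)" "N \<le> length w"
  shows "\<psi> w = \<phi> w"
proof (cases "w \<in> dom \<psi>")
  case True
  then obtain v where "w @ v \<in> dom \<phi>"
    using assms(1) unfolding essential_extension_iff by blast
  with assms(2,3) have "w \<in> dom \<phi>"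
    unfolding decided_from_def by blast
  with assms(1) show ?thesis
    by (auto simp: essential_extension_iff map_le_def)
next
  case False
  with assms(1) show ?thesis
    unfolding essential_extension_iff map_le_def by (metis domIff)
qed

lemma decided_from_essential_extension:
  assumes "essential_extension \<psi> \<phi>" "decided_from N (dom \<phi>)"
  shows "decided_from N (dom \<psi>)"
  unfolding decided_from_def
proof (intro allI impI)
  fix w v assume w: "N \<le> length w" and "w @ v \<in> dom \<psi>"
  then have "w @ v \<in> dom \<phi>"
    using essential_extension_same_value[OF assms, of "w @ v"] by (simp add: domIff)
  with w have "w \<in> dom \<phi>"
    using assms(2) unfolding decided_from_def by blast
  then show "w \<in> dom \<psi>"
    using essential_extension_same_value[OF assms w] by (simp add: domIff)
qed

text \<open>
  Essential extensions keep the length at which the domain is decided, so maximal extensions again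
  have finitely generated domains. Conversely, an inextensible homomorphism is its own maximal
  extension, and its range is finitely generated together with its domain.
\<close>

lemma carrier_thompson_higman_monoid:
  "carrier (thompson_higman_monoid :: ('a::finite list \<rightharpoonup> 'a list) monoid) =
     {\<psi>. right_ideal_hom \<psi> \<and> (\<exists>N. decided_from N (dom \<psi>)) \<and> inextensible \<psi>}"
    (is "?M = ?N")
proof (intro equalityI subsetI)
  fix \<psi> :: "'a list \<rightharpoonup> 'a list" assume "\<psi> \<in> ?M"
  then obtain \<phi> where \<psi>: "\<psi> = max_extension \<phi>"
    and \<phi>: "right_ideal_hom \<phi>" "fg_right_ideal (dom \<phi>)"
    by (auto simp: thompson_higman_monoid_def)
  have ess: "essential_extension \<psi> \<phi>"
    using \<phi>(1) essential_extension_max_extension \<psi> by blast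
  moreover obtain N where "decided_from N (dom \<phi>)"
    using \<phi>(2) by (auto simp: fg_right_ideal_iff_decided_from)
  ultimately have "decided_from N (dom \<psi>)"
    using decided_from_essential_extension by blast
  with ess show "\<psi> \<in> ?N"
    using inextensible_max_extension[OF \<phi>(1)] by (auto simp: essential_extension_iff \<psi>)
next
  fix \<psi> :: "'a list \<rightharpoonup> 'a list" assume "\<psi> \<in> ?N"
  then have hom: "right_ideal_hom \<psi>" and fg: "fg_right_ideal (dom \<psi>)" and "inextensible \<psi>"
    by (auto simp: fg_right_ideal_iff_decided_from right_ideal_hom_def)
  then have "\<psi> = max_extension \<psi>"
    using essential_extension_max_extension unfolding inextensible_def by metis
  with hom fg fg_right_ideal_ran show "\<psi> \<in> ?M"
    unfolding thompson_higman_monoid_def by auto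
qed

text \<open>
  Short words carry no information: every word has long extensions, so cutting the domain down to
  long words is undone by maximal extension.
\<close>

lemma inextensible_eqI:
  assumes \<phi>: "right_ideal_hom \<phi>" "inextensible \<phi>"
    and \<psi>: "right_ideal_hom \<psi>" "inextensible \<psi>"
    and eq: "\<And>w. n \<le> length w \<Longrightarrow> \<phi> w = \<psi> w"
  shows "\<phi> = \<psi>"
proof -
  \<comment> \<open>both maps are essential extensions of their common restriction\<close>
  let ?L = "{w :: 'a list. n \<le> length w}"
  have ess: "essential_extension \<chi> (\<chi> |` ?L)"
    if hom: "right_ideal_hom \<chi>" for \<chi> :: "'a list \<rightharpoonup> 'a list"
    unfolding essential_extension_iff
  proof (intro conjI ballI)
    show "right_ideal_hom (\<chi> |` ?L)"
      using hom right_ideal_hom_append[OF hom]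
      by (auto simp: right_ideal_hom_def right_ideal_def restrict_map_def split: if_splits)
    show "\<chi> |` ?L \<subseteq>\<^sub>m \<chi>"
      by (auto simp: map_le_def)
    show "\<exists>w. x @ w \<in> dom (\<chi> |` ?L)" if "x \<in> dom \<chi>" for x
      using that hom
      by (intro exI[of _ "replicate n undefined"])
        (auto simp: dom_def restrict_map_def dest: right_ideal_hom_append)
  qed (fact hom)
  have "\<phi> |` ?L = \<psi> |` ?L"
    using eq by (auto simp: restrict_map_def)
  then show ?thesis
    using ess[OF \<phi>(1)] ess[OF \<psi>(1)] max_extension_unique \<phi>(2) \<psi>(2) by metis
qed

lemma right_ideal_hom_map_comp:
  assumes "right_ideal_hom \<phi>" "right_ideal_hom \<psi>"
  shows "right_ideal_hom (\<phi> \<circ>\<^sub>m \<psi>)"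
  using assms unfolding right_ideal_hom_def right_ideal_def map_comp_def
  by (auto split: option.splits)

text \<open>
  A homomorphism can shorten a word only within its first \<open>N\<close> letters; the remaining \<open>n\<close> letters
  are copied. Hence long words have long images, on which the outer map of a composition is decided.
\<close>

lemma right_ideal_hom_long_image:
  assumes "right_ideal_hom \<psi>" "decided_from N (dom \<psi>)"
    and "\<psi> w = Some y" "N + n \<le> length w"
  shows "n \<le> length y"
proof -
  \<comment> \<open>already the first \<open>N\<close> letters of \<open>w\<close> form an element of the domain\<close>
  have "take N w \<in> dom \<psi>"
    using assms(3,4) by (intro decided_from_take[OF assms(2)]) auto
  then obtain u where "\<psi> (take N w) = Some u" by auto
  from right_ideal_hom_append[OF assms(1) this, of "drop N w"] assms(3)
  have "y = u @ drop N w" by simp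
  with assms(4) show ?thesis by simp
qed

lemma decided_from_map_comp:
  assumes "right_ideal_hom \<psi>" "decided_from n (dom \<phi>)" "decided_from N (dom \<psi>)"
  shows "decided_from (N + n) (dom (\<phi> \<circ>\<^sub>m \<psi>))"
  unfolding decided_from_def
proof (intro allI impI)
  fix w v assume w: "N + n \<le> length w" and "w @ v \<in> dom (\<phi> \<circ>\<^sub>m \<psi>)"
  then obtain z where z: "\<psi> (w @ v) = Some z" "z \<in> dom \<phi>"
    by (auto simp: map_comp_Some_iff dom_def)
  have "w \<in> dom \<psi>"
    using assms(3) z(1) w unfolding decided_from_def by (metis add_leD1 domI)
  then obtain y where y: "\<psi> w = Some y" by auto
  with z have "y @ v \<in> dom \<phi>"
    using right_ideal_hom_append[OF assms(1) y, of v] by simp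
  then have "y \<in> dom \<phi>"
    using assms(2) right_ideal_hom_long_image[OF assms(1,3) y w] unfolding decided_from_def by blast
  with y show "w \<in> dom (\<phi> \<circ>\<^sub>m \<psi>)"
    by (auto simp: map_comp_Some_iff)
qed


section \<open>Congruence modulo the Cuntz relations\<close>

lemma free_star_algebra_simps [simp]:
  "carrier free_star_algebra = UNIV"
  "x \<otimes>\<^bsub>free_star_algebra\<^esub> y = x * y"
  "x \<oplus>\<^bsub>free_star_algebra\<^esub> y = x + y"
  "\<one>\<^bsub>free_star_algebra\<^esub> = 1"
  "\<zero>\<^bsub>free_star_algebra\<^esub> = 0"
  by (simp_all add: free_star_algebra_def)

lemma a_inv_free_star_algebra [simp]: "\<ominus>\<^bsub>free_star_algebra\<^esub> x = - x"
proof -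
  interpret ring "free_star_algebra :: 'a free_star_alg ring"
    by (rule ring_free_star_algebra)
  show ?thesis by (rule minus_equality) simp_all
qed

lemma a_minus_free_star_algebra [simp]: "x \<ominus>\<^bsub>free_star_algebra\<^esub> y = x - y"
  by (simp add: a_minus_def)

lemma ideal_cuntz_ideal: "ideal (cuntz_ideal :: 'a::finite free_star_alg set) free_star_algebra"
  unfolding cuntz_ideal_def
  by (intro ring.genideal_ideal ring_free_star_algebra) simp

definition cuntz_cong :: "'a::finite free_star_alg \<Rightarrow> 'a free_star_alg \<Rightarrow> bool" (infix "\<approx>" 50)
  where "p \<approx> q \<longleftrightarrow> p - q \<in> cuntz_ideal"

text \<open>
  The coset map to the Cuntz algebra. Identities in the Cuntz algebra are proved below as
  congruences between representatives in the free star-algebra, where ordinary ring arithmetic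
  is available.
\<close>

definition cuntz_class :: "'a::finite free_star_alg \<Rightarrow> 'a free_star_alg set" where
  "cuntz_class p = cuntz_ideal +>\<^bsub>free_star_algebra\<^esub> p"

lemma cuntz_class_eq_iff: "cuntz_class p = cuntz_class q \<longleftrightarrow> p \<approx> q"
  using ring.quotient_eq_iff_same_a_r_cos[OF ring_free_star_algebra ideal_cuntz_ideal, of p q]
  by (simp add: cuntz_class_def cuntz_cong_def)

lemma ring_hom_cuntz_class: "cuntz_class \<in> ring_hom free_star_algebra cuntz_algebra"
  using ideal.rcos_ring_hom[OF ideal_cuntz_ideal]
  unfolding cuntz_algebra_def cuntz_class_def[abs_def] .

lemma cuntz_class_closed: "cuntz_class p \<in> carrier cuntz_algebra"
  using ring_hom_closed[OF ring_hom_cuntz_class, of p] by simp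

lemma cuntz_class_mult: "cuntz_class p \<otimes>\<^bsub>cuntz_algebra\<^esub> cuntz_class q = cuntz_class (p * q)"
  using ring_hom_mult[OF ring_hom_cuntz_class, of p q] by simp

lemma cuntz_class_add: "cuntz_class p \<oplus>\<^bsub>cuntz_algebra\<^esub> cuntz_class q = cuntz_class (p + q)"
  using ring_hom_add[OF ring_hom_cuntz_class, of p q] by simp

lemma cuntz_class_one: "cuntz_class 1 = \<one>\<^bsub>cuntz_algebra\<^esub>"
  using ring_hom_one[OF ring_hom_cuntz_class] by simp

lemma cuntz_cong_refl [simp]: "p \<approx> p"
  by (simp flip: cuntz_class_eq_iff)

lemma cuntz_cong_sym: "p \<approx> q \<Longrightarrow> q \<approx> p"
  by (simp flip: cuntz_class_eq_iff)

lemma cuntz_cong_trans [trans]: "p \<approx> q \<Longrightarrow> q \<approx> r \<Longrightarrow> p \<approx> r"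
  by (simp flip: cuntz_class_eq_iff)

lemma cuntz_cong_add: "p \<approx> p' \<Longrightarrow> q \<approx> q' \<Longrightarrow> p + q \<approx> p' + q'"
  by (simp flip: cuntz_class_eq_iff cuntz_class_add)

lemma cuntz_cong_mult: "p \<approx> p' \<Longrightarrow> q \<approx> q' \<Longrightarrow> p * q \<approx> p' * q'"
  by (simp flip: cuntz_class_eq_iff cuntz_class_mult)

lemma cuntz_cong_sum: "(\<And>x. x \<in> A \<Longrightarrow> f x \<approx> g x) \<Longrightarrow> sum f A \<approx> sum g A"
  by (induction A rule: infinite_finite_induct) (auto intro: cuntz_cong_add)

lemma cuntz_cong_relator: "p - q \<in> cuntz_relators \<Longrightarrow> p \<approx> q"
  using ring.genideal_self[OF ring_free_star_algebra, of "cuntz_relators \<union> star ` cuntz_relators"]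
  by (auto simp: cuntz_cong_def cuntz_ideal_def)

lemma bar_gen_cong: "bar i * gen j \<approx> (if i = j then 1 else 0)"
  by (rule cuntz_cong_relator) (auto simp: cuntz_relators_def)

lemma sum_gen_bar_cong: "(\<Sum>i\<in>UNIV. gen i * bar i) \<approx> 1"
  by (rule cuntz_cong_relator) (simp add: cuntz_relators_def)


section \<open>Products of words in the Cuntz algebra\<close>

definition gen_word :: "'a list \<Rightarrow> 'a free_star_alg" where
  "gen_word u = Poly_Mapping.single (map Gen u) 1"

text \<open>
  The star-inverse of \<open>u\<close>: its letters occur in reverse order, so that \<open>bar_word u\<close> cancels
  \<open>gen_word u\<close> on the left.
\<close>

definition bar_word :: "'a list \<Rightarrow> 'a free_star_alg" where
  "bar_word u = Poly_Mapping.single (rev (map Bar u)) 1"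

lemma single_Nil: "Poly_Mapping.single [] 1 = 1"
  by (metis single_one zero_list_def)

lemma gen_word_Nil [simp]: "gen_word [] = 1"
  by (simp add: gen_word_def single_Nil)

lemma bar_word_Nil [simp]: "bar_word [] = 1"
  by (simp add: bar_word_def single_Nil)

lemma gen_word_append: "gen_word (u @ v) = gen_word u * gen_word v"
  by (simp add: gen_word_def mult_single plus_list_def)

lemma bar_word_append: "bar_word (u @ v) = bar_word v * bar_word u"
  by (simp add: bar_word_def mult_single plus_list_def)

lemma gen_word_Cons: "gen_word (a # u) = gen a * gen_word u"
  by (simp add: gen_word_def gen_def mult_single plus_list_def)

lemma bar_word_Cons: "bar_word (a # u) = bar_word u * bar a"
  by (simp add: bar_word_def bar_def mult_single plus_list_def)

text \<open>
  The relations \<open>bar i * gen j = \<delta>\<^sub>i\<^sub>j\<close> cancel matching letters from the middle outwards: \<open>bar_word u\<close>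
  deletes the prefix \<open>u\<close>, and annihilates a word that does not start with it.
\<close>

lemma bar_word_gen_word_cong:
  assumes "length u \<le> length v"
  shows "bar_word u * gen_word v \<approx>
    (if take (length u) v = u then gen_word (drop (length u) v) else 0)"
  using assms
proof (induction u arbitrary: v)
  case (Cons a u)
  then obtain b v' where v: "v = b # v'" and len: "length u \<le> length v'"
    by (cases v) auto
  have "bar_word (a # u) * gen_word v = bar_word u * (bar a * gen b) * gen_word v'"
    by (simp add: v gen_word_Cons bar_word_Cons mult.assoc)
  also have "\<dots> \<approx> bar_word u * (if a = b then 1 else 0) * gen_word v'"
    by (intro cuntz_cong_mult bar_gen_cong cuntz_cong_refl)
  also have "\<dots> = (if a = b then bar_word u * gen_word v' else 0)"
    by simp
  also have "\<dots> \<approx> (if take (length (a # u)) v = a # u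
      then gen_word (drop (length (a # u)) v) else 0)"
    using Cons.IH[OF len] by (auto simp: v)
  finally show ?case .
qed simp

text \<open>
  Inserting \<open>1 = \<Sum>\<^sub>a gen a * bar a\<close> in the middle replaces a word by its one-letter extensions.
\<close>

lemma gen_word_bar_word_split:
  "gen_word u * bar_word w \<approx> (\<Sum>a\<in>UNIV. gen_word (u @ [a]) * bar_word (w @ [a]))"
proof -
  have "(\<Sum>a\<in>UNIV. gen_word (u @ [a]) * bar_word (w @ [a])) =
      gen_word u * (\<Sum>a\<in>UNIV. gen a * bar a) * bar_word w"
    by (simp add: gen_word_append bar_word_append gen_word_Cons bar_word_Cons
        sum_distrib_left sum_distrib_right mult.assoc)
  also have "\<dots> \<approx> gen_word u * 1 * bar_word w"
    by (intro cuntz_cong_mult sum_gen_bar_cong cuntz_cong_refl)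
  finally show ?thesis
    by (simp add: cuntz_cong_sym)
qed


section \<open>From right ideal homomorphisms to the Cuntz algebra\<close>

text \<open>
  Represents the element of the Cuntz algebra that replaces a prefix \<open>w\<close> in the domain, of the
  fixed length \<open>n\<close>, by its image. The sum runs over all such words and not over the prefix code of the domain because
  words of equal length are pairwise incomparable and do not depend on \<open>\<phi>\<close>, which makes sums for
  different homomorphisms comparable. It encodes \<open>\<phi>\<close> only once \<open>n\<close> is so large that
  the domain is decided at length \<open>n\<close>.
\<close>

definition level_sum :: "nat \<Rightarrow> ('a::finite list \<rightharpoonup> 'a list) \<Rightarrow> 'a free_star_alg" where
  "level_sum n \<phi> =
     (\<Sum>w | w \<in> dom \<phi> \<and> length w = n. gen_word (the (\<phi> w)) * bar_word w)"

lemma finite_level [simp]: "finite {w :: 'a::finite list. w \<in> R \<and> length w = n}"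
  using finite_lists_length_eq[of "UNIV :: 'a set" n] by simp

text \<open>
  From a length where the domain is decided, its words of length \<open>n + 1\<close> are exactly the one-letter
  extensions of its words of length \<open>n\<close>, and \<open>\<phi>\<close> commutes with appending the letter. So each term
  splits into those of the next level.
\<close>

lemma level_sum_Suc:
  assumes hom: "right_ideal_hom \<phi>" and dec: "decided_from N (dom \<phi>)" and "N \<le> n"
  shows "level_sum (Suc n) \<phi> \<approx> level_sum n \<phi>"
proof -
  let ?W = "\<lambda>n. {w. w \<in> dom \<phi> \<and> length w = n}"
  have ideal: "right_ideal (dom \<phi>)"
    using hom by (simp add: right_ideal_hom_def)
  have bij: "bij_betw (\<lambda>(w, a). w @ [a]) (?W n \<times> UNIV) (?W (Suc n))"
    unfolding bij_betw_def
  proof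
    show "(\<lambda>(w, a). w @ [a]) ` (?W n \<times> UNIV) = ?W (Suc n)"
    proof (intro equalityI subsetI)
      fix x assume "x \<in> (\<lambda>(w, a). w @ [a]) ` (?W n \<times> UNIV)"
      then obtain w a where "x = w @ [a]" "w \<in> dom \<phi>" "length w = n" by auto
      then show "x \<in> ?W (Suc n)"
        using ideal unfolding right_ideal_def
        by (metis (mono_tags, lifting) length_append_singleton mem_Collect_eq)
    next
      fix x assume x: "x \<in> ?W (Suc n)"
      then obtain w a where w: "x = w @ [a]" "length w = n"
        by (auto simp: length_Suc_conv_rev)
      with x dec \<open>N \<le> n\<close> have "w \<in> dom \<phi>"
        unfolding decided_from_def by blast
      with w show "x \<in> (\<lambda>(w, a). w @ [a]) ` (?W n \<times> UNIV)" by force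
    qed
  qed (auto simp: inj_on_def)
  have "level_sum (Suc n) \<phi> =
      (\<Sum>(w, a)\<in>?W n \<times> UNIV. gen_word (the (\<phi> (w @ [a]))) * bar_word (w @ [a]))"
    unfolding level_sum_def
    by (subst sum.reindex_bij_betw[OF bij, symmetric]) (simp add: case_prod_unfold)
  also have "\<dots> = (\<Sum>w\<in>?W n. \<Sum>a\<in>UNIV. gen_word (the (\<phi> w) @ [a]) * bar_word (w @ [a]))"
    by (subst sum.cartesian_product[symmetric])
      (auto intro!: sum.cong simp: right_ideal_hom_append[OF hom])
  also have "\<dots> \<approx> level_sum n \<phi>"
    unfolding level_sum_def
    by (intro cuntz_cong_sum cuntz_cong_sym[OF gen_word_bar_word_split])
  finally show ?thesis .
qed

lemma level_sum_cong:
  assumes "right_ideal_hom \<phi>" "decided_from N (dom \<phi>)" "N \<le> n"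
  shows "level_sum n \<phi> \<approx> level_sum N \<phi>"
  using \<open>N \<le> n\<close>
proof (induction n rule: dec_induct)
  case (step n)
  then show ?case
    using level_sum_Suc[OF assms(1,2)] cuntz_cong_trans by blast
qed simp

lemma level_sum_essential_extension:
  assumes "essential_extension \<psi> \<phi>" "decided_from N (dom \<phi>)" "N \<le> n"
  shows "level_sum n \<psi> = level_sum n \<phi>"
proof -
  have eq: "\<psi> w = \<phi> w" if "length w = n" for w
    using essential_extension_same_value[OF assms(1,2)] that assms(3) by blast
  show ?thesis
    unfolding level_sum_def by (intro sum.cong) (auto simp: eq domIff)
qed

text \<open>
  The level \<open>N + n\<close> for \<open>\<psi>\<close> is chosen so that every image \<open>\<psi>(w)\<close> has length at least \<open>n\<close>. In the
  product of the two sums, \<open>bar_word u * gen_word (\<psi>(w))\<close> then vanishes unless \<open>u\<close> is the prefix of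
  length \<open>n\<close> of \<open>\<psi>(w)\<close>. Such a \<open>u\<close> lies in the domain of \<open>\<phi>\<close> iff \<open>\<psi>(w)\<close> does, and the
  surviving term is the one of the composition at \<open>w\<close>.
\<close>

lemma level_sum_mult:
  assumes \<phi>: "right_ideal_hom \<phi>" "decided_from n (dom \<phi>)"
    and \<psi>: "right_ideal_hom \<psi>" "decided_from N (dom \<psi>)"
  shows "level_sum n \<phi> * level_sum (N + n) \<psi> \<approx> level_sum (N + n) (\<phi> \<circ>\<^sub>m \<psi>)"
proof -
  let ?U = "{u. u \<in> dom \<phi> \<and> length u = n}" and ?W = "{w. w \<in> dom \<psi> \<and> length w = N + n}"
  let ?x = "\<lambda>w. the (\<psi> w)"
  have ideal: "right_ideal (dom \<phi>)"
    using \<phi>(1) by (simp add: right_ideal_hom_def)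
  \<comment> \<open>the inner sum over \<open>u\<close>, for a fixed word \<open>w\<close> in the domain of \<open>\<psi>\<close>\<close>
  have row: "(\<Sum>u\<in>?U. (gen_word (the (\<phi> u)) * bar_word u) * (gen_word (?x w) * bar_word w)) \<approx>
      (if ?x w \<in> dom \<phi> then gen_word (the (\<phi> (?x w))) * bar_word w else 0)"
    if "w \<in> ?W" for w
  proof -
    obtain x where x: "\<psi> w = Some x" "length w = N + n"
      using \<open>w \<in> ?W\<close> by auto
    have len: "n \<le> length x"
      using right_ideal_hom_long_image[OF \<psi> x(1)] x(2) by simp
    have dom_iff: "take n x \<in> dom \<phi> \<longleftrightarrow> x \<in> dom \<phi>"
      using decided_from_append_iff[OF \<phi>(2) ideal, of "take n x" "drop n x"] len by simp
    have val: "the (\<phi> x) = the (\<phi> (take n x)) @ drop n x" if "take n x \<in> dom \<phi>"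
    proof -
      from that obtain y where "\<phi> (take n x) = Some y" by auto
      from right_ideal_hom_append[OF \<phi>(1) this, of "drop n x"] this show ?thesis by simp
    qed
    have "(\<Sum>u\<in>?U. (gen_word (the (\<phi> u)) * bar_word u) * (gen_word x * bar_word w)) =
        (\<Sum>u\<in>?U. gen_word (the (\<phi> u)) * (bar_word u * gen_word x) * bar_word w)"
      by (simp add: mult.assoc)
    also have "\<dots> \<approx> (\<Sum>u\<in>?U. gen_word (the (\<phi> u)) *
        (if take (length u) x = u then gen_word (drop (length u) x) else 0) * bar_word w)"
      using len by (intro cuntz_cong_sum cuntz_cong_mult bar_word_gen_word_cong cuntz_cong_refl) auto
    also have "\<dots> = (\<Sum>u\<in>?U. if u = take n x
        then gen_word (the (\<phi> (take n x)) @ drop n x) * bar_word w else 0)"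
      by (intro sum.cong) (use len in \<open>auto simp: gen_word_append min_absorb2\<close>)
    also have "\<dots> = (if x \<in> dom \<phi> then gen_word (the (\<phi> x)) * bar_word w else 0)"
      using len by (simp add: sum.delta dom_iff val)
    finally show ?thesis
      unfolding x(1) option.sel .
  qed
  have "level_sum n \<phi> * level_sum (N + n) \<psi> =
      (\<Sum>w\<in>?W. \<Sum>u\<in>?U. (gen_word (the (\<phi> u)) * bar_word u) * (gen_word (?x w) * bar_word w))"
    unfolding level_sum_def sum_product by (rule sum.swap)
  also have "\<dots> \<approx> (\<Sum>w\<in>?W. if ?x w \<in> dom \<phi> then gen_word (the (\<phi> (?x w))) * bar_word w else 0)"
    using row by (rule cuntz_cong_sum)
  also have "\<dots> = (\<Sum>w\<in>{w\<in>?W. ?x w \<in> dom \<phi>}. gen_word (the (\<phi> (?x w))) * bar_word w)"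
    by (rule sum.inter_filter[symmetric]) simp
  also have "\<dots> = level_sum (N + n) (\<phi> \<circ>\<^sub>m \<psi>)"
    unfolding level_sum_def
    by (rule sum.cong) (auto simp: map_comp_def dom_def split: option.splits)
  finally show ?thesis .
qed

lemma level_sum_Some: "level_sum 0 Some = 1"
proof -
  have "{w :: 'a list. w \<in> dom Some \<and> length w = 0} = {[]}" by auto
  then show ?thesis by (simp add: level_sum_def)
qed

text \<open>
  All levels from which the domain is decided give the same class; the least one is just a
  definite choice.
\<close>

definition cuntz_image :: "('a::finite list \<rightharpoonup> 'a list) \<Rightarrow> 'a free_star_alg set" where
  "cuntz_image \<phi> = cuntz_class (level_sum (LEAST N. decided_from N (dom \<phi>)) \<phi>)"

lemma cuntz_image_eq:
  assumes "right_ideal_hom \<phi>" "decided_from N (dom \<phi>)" "N \<le> n"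
  shows "cuntz_image \<phi> = cuntz_class (level_sum n \<phi>)"
proof -
  let ?N = "LEAST N. decided_from N (dom \<phi>)"
  have "decided_from ?N (dom \<phi>)" "?N \<le> n"
    using assms(2,3) Least_le[of "\<lambda>N. decided_from N (dom \<phi>)" N]
    by (auto intro: LeastI)
  then show ?thesis
    unfolding cuntz_image_def cuntz_class_eq_iff
    using level_sum_cong[OF assms(1)] cuntz_cong_sym by blast
qed

lemma cuntz_image_max_extension:
  assumes "right_ideal_hom \<phi>" "decided_from N (dom \<phi>)"
  shows "cuntz_image (max_extension \<phi>) = cuntz_image \<phi>"
proof -
  have ess: "essential_extension (max_extension \<phi>) \<phi>"
    using essential_extension_max_extension assms(1) .
  then have "right_ideal_hom (max_extension \<phi>)" "decided_from N (dom (max_extension \<phi>))"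
    using decided_from_essential_extension[OF _ assms(2)]
    by (auto simp: essential_extension_iff)
  then have "cuntz_image (max_extension \<phi>) = cuntz_class (level_sum N (max_extension \<phi>))"
    by (rule cuntz_image_eq) simp
  also have "\<dots> = cuntz_image \<phi>"
    using level_sum_essential_extension[OF ess assms(2)] cuntz_image_eq[OF assms, of N] by simp
  finally show ?thesis .
qed

lemma cuntz_image_mult:
  assumes \<phi>: "right_ideal_hom \<phi>" "decided_from n (dom \<phi>)"
    and \<psi>: "right_ideal_hom \<psi>" "decided_from N (dom \<psi>)"
  shows "cuntz_image \<phi> \<otimes>\<^bsub>cuntz_algebra\<^esub> cuntz_image \<psi> = cuntz_image (\<phi> \<circ>\<^sub>m \<psi>)"
proof -
  have "cuntz_image (\<phi> \<circ>\<^sub>m \<psi>) = cuntz_class (level_sum (N + n) (\<phi> \<circ>\<^sub>m \<psi>))"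
    using right_ideal_hom_map_comp[OF \<phi>(1) \<psi>(1)] decided_from_map_comp[OF \<psi>(1) \<phi>(2) \<psi>(2)]
    by (intro cuntz_image_eq) auto
  also have "\<dots> = cuntz_class (level_sum n \<phi> * level_sum (N + n) \<psi>)"
    using level_sum_mult[OF \<phi> \<psi>] by (simp add: cuntz_class_eq_iff cuntz_cong_sym)
  also have "\<dots> = cuntz_image \<phi> \<otimes>\<^bsub>cuntz_algebra\<^esub> cuntz_image \<psi>"
    using cuntz_image_eq[OF \<phi>, of n] cuntz_image_eq[OF \<psi>, of "N + n"]
    by (simp add: cuntz_class_mult)
  finally show ?thesis ..
qed


section \<open>The Cuntz algebra acts on functions of infinite words\<close>

text \<open>
  Both the involution and the action below are defined by summing a contribution of each monomial.
  The supports of \<open>p\<close>, \<open>q\<close> and \<open>p + q\<close> differ, but outside the support the contributions are zero,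
  so all three sums may be taken over a common finite set.
\<close>

lemma additive_sum_keys:
  assumes "\<And>w. additive (F w)"
  shows "additive (\<lambda>p. \<Sum>w\<in>Poly_Mapping.keys p. F w (Poly_Mapping.lookup p w))"
proof
  fix p q :: "'a \<Rightarrow>\<^sub>0 'b"
  have superset: "(\<Sum>w\<in>Poly_Mapping.keys r. F w (Poly_Mapping.lookup r w)) =
      (\<Sum>w\<in>A. F w (Poly_Mapping.lookup r w))"
    if "finite A" "Poly_Mapping.keys r \<subseteq> A" for r and A :: "'a set"
    using that additive.zero[OF assms]
    by (intro sum.mono_neutral_left) (auto simp: in_keys_iff)
  let ?A = "Poly_Mapping.keys p \<union> Poly_Mapping.keys q"
  show "(\<Sum>w\<in>Poly_Mapping.keys (p + q). F w (Poly_Mapping.lookup (p + q) w)) =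
      (\<Sum>w\<in>Poly_Mapping.keys p. F w (Poly_Mapping.lookup p w)) +
      (\<Sum>w\<in>Poly_Mapping.keys q. F w (Poly_Mapping.lookup q w))"
    using superset[of ?A "p + q"] superset[of ?A p] superset[of ?A q] keys_add[of p q]
    by (simp add: lookup_add additive.add[OF assms] sum.distrib)
qed

lemma additive_star: "additive star"
  unfolding star_def[abs_def]
  by (rule additive_sum_keys) (unfold_locales, simp add: single_add)

lemma star_single: "star (Poly_Mapping.single w c) =
    Poly_Mapping.single (rev (map bar_letter w)) (cnj c)"
  by (simp add: star_def)

text \<open>
  The involution permutes the relators, so the star-closed ideal is already generated by the
  relators alone, and only these have to be checked in a representation.
\<close>

lemma star_cuntz_relators: "star ` cuntz_relators \<subseteq> cuntz_relators"
proof -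
  have one: "star 1 = 1"
    using star_single[of "[]" 1] by (simp add: single_Nil)
  have bar_gen: "star (bar i * gen j) = bar j * gen i" for i j :: 'a
    by (simp add: bar_def gen_def mult_single plus_list_def star_single)
  have gen_bar: "star (gen i * bar i) = gen i * bar i" for i :: 'a
    by (simp add: bar_def gen_def mult_single plus_list_def star_single)
  have "star p \<in> cuntz_relators" if "p \<in> cuntz_relators" for p :: "'a free_star_alg"
  proof -
    from that consider i where "p = bar i * gen i - 1" | i j where "p = bar i * gen j" "i \<noteq> j"
      | "p = (\<Sum>i\<in>UNIV. gen i * bar i) - 1"
      unfolding cuntz_relators_def by blast
    then show ?thesis
    proof cases
      case 1
      then have "star p = bar i * gen i - 1"
        by (simp add: additive.diff[OF additive_star] one bar_gen)
      then show ?thesis unfolding cuntz_relators_def by blast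
    next
      case 2
      then have "star p = bar j * gen i" by (simp add: bar_gen)
      with \<open>i \<noteq> j\<close> show ?thesis unfolding cuntz_relators_def by blast
    next
      case 3
      then have "star p = (\<Sum>i\<in>UNIV. gen i * bar i) - 1"
        by (simp add: additive.diff[OF additive_star] additive.sum[OF additive_star] one gen_bar)
      then show ?thesis unfolding cuntz_relators_def by blast
    qed
  qed
  then show ?thesis by blast
qed

text \<open>
  On complex functions of infinite words, \<open>Gen a\<close> moves the indicator of \<open>s\<close> to that of \<open>a s\<close>,
  and \<open>Bar a\<close> undoes this, sending to zero the indicators of words that do not start with \<open>a\<close>.
  Infinite words are used because each has a first letter, so that \<open>\<Sum>\<^sub>a gen a * bar a\<close> acts as the
  identity; on finite words the empty word would be lost.
\<close>

fun letter_action :: "'a letter \<Rightarrow> ('a stream \<Rightarrow> complex) \<Rightarrow> 'a stream \<Rightarrow> complex" where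
  "letter_action (Gen a) f s = (if shd s = a then f (stl s) else 0)"
| "letter_action (Bar a) f s = f (a ## s)"

definition action :: "'a free_star_alg \<Rightarrow> ('a stream \<Rightarrow> complex) \<Rightarrow> 'a stream \<Rightarrow> complex" where
  "action p f s =
     (\<Sum>w\<in>Poly_Mapping.keys p. Poly_Mapping.lookup p w * foldr letter_action w f s)"

lemma additive_action: "additive (\<lambda>p. action p f s)"
  unfolding action_def
  by (rule additive_sum_keys) (unfold_locales, simp add: algebra_simps)

lemmas action_add = additive.add[OF additive_action]
  and action_zero = additive.zero[OF additive_action]
  and action_minus = additive.minus[OF additive_action]
  and action_diff = additive.diff[OF additive_action]
  and action_sum = additive.sum[OF additive_action]

lemma action_single: "action (Poly_Mapping.single w c) f s = c * foldr letter_action w f s"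
  by (simp add: action_def)

lemma foldr_letter_action_sum:
  "foldr letter_action w (\<lambda>s. \<Sum>v\<in>A. c v * g v s) t = (\<Sum>v\<in>A. c v * foldr letter_action w (g v) t)"
proof (induction w arbitrary: t)
  case (Cons l w)
  have "foldr letter_action w (\<lambda>s. \<Sum>v\<in>A. c v * g v s) =
      (\<lambda>t. \<Sum>v\<in>A. c v * foldr letter_action w (g v) t)"
    using Cons by blast
  then show ?case
    by (cases l) auto
qed simp

text \<open>
  Expanding both factors into monomials reduces this to concatenation of words acting as composition.
\<close>

lemma action_mult: "action (p * q) f s = action p (action q f) s"
proof -
  have expand: "r = (\<Sum>w\<in>Poly_Mapping.keys r. Poly_Mapping.single w (Poly_Mapping.lookup r w))"
    for r :: "'a free_star_alg"
    by (rule poly_mapping_eqI) (simp add: lookup_sum lookup_single when_def in_keys_iff)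
  have "p * q = (\<Sum>w\<in>Poly_Mapping.keys p. \<Sum>v\<in>Poly_Mapping.keys q.
      Poly_Mapping.single (w @ v) (Poly_Mapping.lookup p w * Poly_Mapping.lookup q v))"
    by (subst (1) expand[of p], subst (1) expand[of q])
      (simp add: sum_product mult_single plus_list_def)
  then have "action (p * q) f s = (\<Sum>w\<in>Poly_Mapping.keys p. \<Sum>v\<in>Poly_Mapping.keys q.
      Poly_Mapping.lookup p w * Poly_Mapping.lookup q v *
      foldr letter_action w (foldr letter_action v f) s)"
    by (simp add: action_sum action_single)
  also have "\<dots> = action p (action q f) s"
    unfolding action_def[of p] action_def[of q, abs_def] foldr_letter_action_sum
    by (simp add: sum_distrib_left mult.assoc)
  finally show ?thesis .
qed

lemma action_cuntz_relator:
  assumes "p \<in> cuntz_relators"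
  shows "action p f s = 0"
proof -
  have one: "action 1 f s = f s" for f :: "'a stream \<Rightarrow> complex" and s
    using action_single[of "[]" 1 f s] by (simp add: single_Nil)
  have gen: "action (gen a) f = letter_action (Gen a) f"
    and bar: "action (bar a) f = letter_action (Bar a) f" for a and f :: "'a stream \<Rightarrow> complex"
    by (auto simp: gen_def bar_def action_single)
  have "(\<Sum>a\<in>UNIV. if shd s = a then f (a ## stl s) else 0) = f s"
    by (simp add: sum.delta)
  with assms show ?thesis
    unfolding cuntz_relators_def
    by (auto simp: action_diff action_sum action_mult one gen bar)
qed

text \<open>
  The elements acting as zero form an ideal that contains the relators. Hence the Cuntz algebra acts
  as well, and elements with different operators have different cosets.
\<close>

lemma action_cuntz_ideal:
  assumes "p \<in> cuntz_ideal"
  shows "action p f s = 0"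
proof -
  let ?J = "{p :: 'a free_star_alg. \<forall>f s. action p f s = 0}"
  have vanish: "action p (\<lambda>s. 0) s = 0" for p :: "'a free_star_alg" and s
  proof -
    have "action 0 f = (\<lambda>s. 0)" by (simp add: action_zero fun_eq_iff)
    with action_mult[of p 0 f s] show ?thesis by (simp add: action_zero)
  qed
  have "subgroup ?J (add_monoid free_star_algebra)"
  proof
    fix x assume "x \<in> ?J"
    moreover have "inv\<^bsub>add_monoid free_star_algebra\<^esub> x = - x"
      using a_inv_free_star_algebra[of x] by (simp add: a_inv_def)
    ultimately show "inv\<^bsub>add_monoid free_star_algebra\<^esub> x \<in> ?J"
      by (simp add: action_minus)
  qed (auto simp: action_add action_zero)
  moreover have "action (x * a) f s = 0 \<and> action (a * x) f s = 0"
    if "a \<in> ?J" for a x :: "'a free_star_alg" and f s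
  proof -
    from that have "action a f = (\<lambda>s. 0)" for f by (simp add: fun_eq_iff)
    then show ?thesis by (simp add: action_mult vanish)
  qed
  ultimately have "ideal ?J free_star_algebra"
    by (intro idealI ring_free_star_algebra) auto
  moreover have "cuntz_relators \<union> star ` cuntz_relators \<subseteq> ?J"
    using star_cuntz_relators action_cuntz_relator by blast
  ultimately have "cuntz_ideal \<subseteq> ?J"
    unfolding cuntz_ideal_def by (intro ring.genideal_minimal ring_free_star_algebra)
  with assms show ?thesis by blast
qed

lemma foldr_letter_action_bar_word: "foldr letter_action (rev (map Bar w)) f s = f (w @- s)"
  by (induction w arbitrary: f) simp_all

lemma foldr_letter_action_gen_word:
  "foldr letter_action (map Gen u) f s =
     (if stake (length u) s = u then f (sdrop (length u) s) else 0)"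
  by (induction u arbitrary: s) simp_all

lemma shift_eq_shift_iff:
  assumes "length u = length v"
  shows "u @- s = v @- t \<longleftrightarrow> u = v \<and> s = t"
  using assms by (induction u v rule: list_induct2) auto

text \<open>
  The level sum of \<open>\<phi>\<close> maps the indicator of \<open>w t\<close> to that of \<open>\<phi>(w) t\<close>, or to zero if \<open>\<phi>(w)\<close> is
  undefined; the other terms vanish because \<open>w\<close> is the only prefix of length \<open>n\<close>. So the
  operator remembers the values of \<open>\<phi>\<close>.
\<close>

lemma action_level_sum_indicator:
  assumes "length w = n"
  shows "action (level_sum n \<phi>) (\<lambda>s. if s = w @- t then 1 else 0) s =
    (if w \<in> dom \<phi> \<and> s = the (\<phi> w) @- t then 1 else 0)"
proof -
  let ?f = "\<lambda>s. if s = w @- t then 1 else (0 :: complex)"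
  have summand: "action (gen_word u * bar_word v) ?f s =
      (if v = w then if s = u @- t then 1 else 0 else 0)"
    if "length v = n" for u v
  proof -
    have "v @- r = w @- t \<longleftrightarrow> v = w \<and> r = t" for r
      by (rule shift_eq_shift_iff) (simp add: that assms)
    moreover have "stake (length u) s = u \<and> sdrop (length u) s = t \<longleftrightarrow> s = u @- t"
      using shift_eq_shift_iff[of "stake (length u) s" u "sdrop (length u) s" t]
      by (simp add: stake_sdrop)
    ultimately show ?thesis
      by (auto simp: gen_word_def bar_word_def mult_single plus_list_def action_single
          foldr_letter_action_bar_word foldr_letter_action_gen_word)
  qed
  have "action (level_sum n \<phi>) ?f s =
      (\<Sum>v | v \<in> dom \<phi> \<and> length v = n. if v = w then if s = the (\<phi> v) @- t then 1 else 0 else 0)"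
    unfolding level_sum_def action_sum by (intro sum.cong) (auto simp: summand)
  also have "\<dots> = (if w \<in> dom \<phi> \<and> s = the (\<phi> w) @- t then 1 else 0)"
    using assms by (simp add: sum.delta)
  finally show ?thesis .
qed

text \<open>
  If one word were a proper prefix of the other, a non-empty word \<open>v\<close> would satisfy \<open>v t = t\<close> for all
  \<open>t\<close>. With a second letter \<open>b\<close> available, different from the first letter of \<open>v\<close>, the constant
  word \<open>t = b b b \<dots>\<close> refutes this. Over a one-letter alphabet the conclusion fails.
\<close>

lemma shift_determines_prefix:
  assumes "card (UNIV :: 'a::finite set) \<ge> 2" and "\<And>t :: 'a stream. u @- t = v @- t"
  shows "u = v"
proof -
  have nontrivial: "\<exists>t. a ## (x @- t) \<noteq> t" for a :: 'a and x
  proof -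
    obtain b where "b \<noteq> a"
      using assms(1)
      by (metis (full_types) UNIV_I card_le_Suc0_iff_eq finite_class.finite_UNIV
          not_less_eq_eq numeral_2_eq_2)
    then have "shd (a ## (x @- sconst b)) \<noteq> shd (sconst b)" by simp
    then show ?thesis by metis
  qed
  from assms(2) show ?thesis
  proof (induction u arbitrary: v)
    case Nil
    note shift_eq = this
    show ?case
    proof (cases v)
      case (Cons a v')
      with shift_eq have "a ## (v' @- t) = t" for t by (metis shift.simps)
      with nontrivial show ?thesis by blast
    qed simp
  next
    case (Cons a u)
    note shift_eq = Cons.prems
    show ?case
    proof (cases v)
      case Nil
      with shift_eq have "a ## (u @- t) = t" for t by simp
      with nontrivial show ?thesis by blast
    next
      case v: (Cons b v')
      with shift_eq have "a = b" "u @- t = v' @- t" for t by simp_all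
      with v Cons.IH show ?thesis by blast
    qed
  qed
qed

text \<open>
  For every infinite word \<open>t\<close>, the two sums map the indicator of \<open>w t\<close> to the same function, which is
  the indicator of \<open>y t\<close>.
\<close>

lemma level_sum_determines_value:
  fixes \<phi> \<psi> :: "'a::finite list \<rightharpoonup> 'a list"
  assumes "card (UNIV :: 'a set) \<ge> 2" and "level_sum n \<phi> \<approx> level_sum n \<psi>"
    and "length w = n" "\<phi> w = Some y"
  shows "\<psi> w = Some y"
proof -
  have act: "action (level_sum n \<phi>) f s = action (level_sum n \<psi>) f s" for f s
    using action_cuntz_ideal[of "level_sum n \<phi> - level_sum n \<psi>" f s] assms(2)
    by (simp add: cuntz_cong_def action_diff)
  have *: "w \<in> dom \<psi> \<and> y @- t = the (\<psi> w) @- t" for t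
    using act[of "\<lambda>s. if s = w @- t then 1 else 0" "y @- t"] assms(4)
    unfolding action_level_sum_indicator[OF assms(3)]
    by (auto split: if_splits)
  then have "y = the (\<psi> w)"
    using shift_determines_prefix[OF assms(1)] by blast
  with * show ?thesis by auto
qed

lemma cuntz_image_eqD:
  fixes \<phi> \<psi> :: "'a::finite list \<rightharpoonup> 'a list"
  assumes card: "card (UNIV :: 'a set) \<ge> 2"
    and \<phi>: "right_ideal_hom \<phi>" "decided_from N (dom \<phi>)"
    and \<psi>: "right_ideal_hom \<psi>" "decided_from M (dom \<psi>)"
    and eq: "cuntz_image \<phi> = cuntz_image \<psi>" and long: "max N M \<le> length w"
  shows "\<phi> w = \<psi> w"
proof -
  let ?n = "length w"
  have cong: "level_sum ?n \<phi> \<approx> level_sum ?n \<psi>"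
    using cuntz_image_eq[OF \<phi>, of ?n] cuntz_image_eq[OF \<psi>, of ?n] eq long
    by (simp flip: cuntz_class_eq_iff)
  show ?thesis
    using level_sum_determines_value[OF card cong refl]
      level_sum_determines_value[OF card cuntz_cong_sym[OF cong] refl]
    by (metis option.exhaust)
qed


section \<open>The embedding\<close>

theorem theorem1p12:
  assumes "card (UNIV :: 'a::finite set) \<ge> 2"
  shows "\<exists>N h. submonoid N (cuntz_algebra :: 'a free_star_alg set ring) \<and>
    h \<in> iso (thompson_higman_monoid :: ('a list \<rightharpoonup> 'a list) monoid)
            ((cuntz_algebra :: 'a free_star_alg set ring) \<lparr> carrier := N \<rparr>) \<and>
    h \<one>\<^bsub>thompson_higman_monoid :: ('a list \<rightharpoonup> 'a list) monoid\<^esub> =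
      \<one>\<^bsub>cuntz_algebra :: 'a free_star_alg set ring\<^esub>"
proof -
  let ?M = "thompson_higman_monoid :: ('a list \<rightharpoonup> 'a list) monoid"
  let ?O = "cuntz_algebra :: 'a free_star_alg set ring"
  let ?N = "cuntz_image ` carrier ?M"
  have mult: "\<phi> \<otimes>\<^bsub>?M\<^esub> \<psi> \<in> carrier ?M"
      "cuntz_image (\<phi> \<otimes>\<^bsub>?M\<^esub> \<psi>) = cuntz_image \<phi> \<otimes>\<^bsub>?O\<^esub> cuntz_image \<psi>"
    if "\<phi> \<in> carrier ?M" "\<psi> \<in> carrier ?M" for \<phi> \<psi>
  proof -
    from that obtain n N where \<phi>: "right_ideal_hom \<phi>" "decided_from n (dom \<phi>)"
        and \<psi>: "right_ideal_hom \<psi>" "decided_from N (dom \<psi>)"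
      unfolding carrier_thompson_higman_monoid by blast
    have comp: "right_ideal_hom (\<phi> \<circ>\<^sub>m \<psi>)" "decided_from (N + n) (dom (\<phi> \<circ>\<^sub>m \<psi>))"
      using right_ideal_hom_map_comp[OF \<phi>(1) \<psi>(1)] decided_from_map_comp[OF \<psi>(1) \<phi>(2) \<psi>(2)] .
    have prod: "\<phi> \<otimes>\<^bsub>?M\<^esub> \<psi> = max_extension (\<phi> \<circ>\<^sub>m \<psi>)"
      by (simp add: thompson_higman_monoid_def)
    have "essential_extension (max_extension (\<phi> \<circ>\<^sub>m \<psi>)) (\<phi> \<circ>\<^sub>m \<psi>)"
      using comp(1) by (rule essential_extension_max_extension)
    then show "\<phi> \<otimes>\<^bsub>?M\<^esub> \<psi> \<in> carrier ?M"
      using decided_from_essential_extension[OF _ comp(2)] inextensible_max_extension[OF comp(1)]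
      unfolding carrier_thompson_higman_monoid prod
      by (auto simp: essential_extension_iff)
    show "cuntz_image (\<phi> \<otimes>\<^bsub>?M\<^esub> \<psi>) = cuntz_image \<phi> \<otimes>\<^bsub>?O\<^esub> cuntz_image \<psi>"
      unfolding prod cuntz_image_max_extension[OF comp] cuntz_image_mult[OF \<phi> \<psi>] ..
  qed
  have Some: "right_ideal_hom (Some :: 'a list \<rightharpoonup> 'a list)"
      "decided_from 0 (dom (Some :: 'a list \<rightharpoonup> 'a list))"
    by (auto simp: right_ideal_hom_def right_ideal_def decided_from_def)
  have "inextensible (Some :: 'a list \<rightharpoonup> 'a list)"
    by (auto simp: inextensible_def essential_extension_iff map_le_def)
  with Some have one_closed: "Some \<in> carrier ?M"
    unfolding carrier_thompson_higman_monoid by blast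
  have one: "cuntz_image (Some :: 'a list \<rightharpoonup> 'a list) = \<one>\<^bsub>?O\<^esub>"
    using cuntz_image_eq[OF Some, of 0] by (simp add: level_sum_Some cuntz_class_one)
  have "submonoid ?N ?O"
  proof
    show "?N \<subseteq> carrier ?O"
      by (auto simp: cuntz_image_def cuntz_class_closed)
    show "x \<otimes>\<^bsub>?O\<^esub> y \<in> ?N" if "x \<in> ?N" "y \<in> ?N" for x y
      using that mult by (metis (no_types, lifting) image_iff)
    show "\<one>\<^bsub>?O\<^esub> \<in> ?N"
      using one one_closed by (metis image_eqI)
  qed
  moreover have "inj_on cuntz_image (carrier ?M)"
  proof
    fix \<phi> \<psi> assume "\<phi> \<in> carrier ?M" "\<psi> \<in> carrier ?M" and eq: "cuntz_image \<phi> = cuntz_image \<psi>"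
    then obtain N M where \<phi>: "right_ideal_hom \<phi>" "decided_from N (dom \<phi>)" "inextensible \<phi>"
        and \<psi>: "right_ideal_hom \<psi>" "decided_from M (dom \<psi>)" "inextensible \<psi>"
      unfolding carrier_thompson_higman_monoid by blast
    show "\<phi> = \<psi>"
      using cuntz_image_eqD[OF assms \<phi>(1,2) \<psi>(1,2) eq]
      by (rule inextensible_eqI[OF \<phi>(1,3) \<psi>(1,3)])
  qed
  then have "cuntz_image \<in> iso ?M (?O \<lparr> carrier := ?N \<rparr>)"
    using mult by (auto simp: iso_def hom_def bij_betw_def)
  moreover have "cuntz_image \<one>\<^bsub>?M\<^esub> = \<one>\<^bsub>?O\<^esub>"
    by (simp add: thompson_higman_monoid_def one)
  ultimately show ?thesis by blast
qed

end
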